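(* The number of order-different $k$-XOS functions on $V=[n]$ (i.e., the number of order-equivalence classes of $k$-XOS functions $f\colon 2^{[n]}\to\mathbb{R}$) is $2^{O(k^2n^2)}$.
   Context: A set function $g\colon 2^V\to\mathbb{R}$ is additive if $g(X)=\sum_{v\in X}g(\{v\})$ for all $X\subseteq V$. For an integer $k\ge1$, a function $f\colon 2^V\to\mathbb{R}$ is $k$-XOS if there are additive functions $f_1,\dots,f_k\colon 2^V\to\mathbb{R}$ (values may be negative) with $f(X)=\max_{i\in[k]}f_i(X)$ for all $X\subseteq V$. Two set functions $f,g\colon 2^V\to\mathbb{R}$ are order-equivalent if for all $X,Y\subseteq V$, $f(X)\le f(Y)$ if and only if $g(X)\le g(Y)$; otherwise they are order-different. *)

theory Defs
  imports Complex_Main "HOL-Library.FuncSet"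
begin

definition additive_set_fun :: "'a set \<Rightarrow> ('a set \<Rightarrow> real) \<Rightarrow> bool" where
  "additive_set_fun V g \<longleftrightarrow> (\<forall>X. X \<subseteq> V \<longrightarrow> g X = (\<Sum>v\<in>X. g {v}))"

text \<open>Only meaningful for \<open>k \<ge> 1\<close>, since \<open>Max {}\<close> is unspecified.\<close>

definition k_xos :: "'a set \<Rightarrow> nat \<Rightarrow> ('a set \<Rightarrow> real) \<Rightarrow> bool" where
  "k_xos V k f \<longleftrightarrow>
     (\<exists>F :: nat \<Rightarrow> 'a set \<Rightarrow> real.
        (\<forall>i\<in>{1..k}. additive_set_fun V (F i)) \<and>
        (\<forall>X. X \<subseteq> V \<longrightarrow> f X = Max ((\<lambda>i. F i X) ` {1..k})))"

text \<open>A real function on the power set of \<open>V\<close> is represented by a HOL function that is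
  \<open>undefined\<close> off \<open>Pow V\<close>, so that equality of representatives is equality of set functions.\<close>

definition k_xos_functions :: "'a set \<Rightarrow> nat \<Rightarrow> ('a set \<Rightarrow> real) set" where
  "k_xos_functions V k = {f \<in> Pow V \<rightarrow>\<^sub>E UNIV. k_xos V k f}"

definition order_equivalent :: "'a set \<Rightarrow> ('a set \<Rightarrow> real) \<Rightarrow> ('a set \<Rightarrow> real) \<Rightarrow> bool" where
  "order_equivalent V f g \<longleftrightarrow>
     (\<forall>X Y. X \<subseteq> V \<longrightarrow> Y \<subseteq> V \<longrightarrow> (f X \<le> f Y \<longleftrightarrow> g X \<le> g Y))"

definition order_classes :: "'a set \<Rightarrow> ('a set \<Rightarrow> real) set \<Rightarrow> ('a set \<Rightarrow> real) set set" where
  "order_classes V A = A // {(f, g). f \<in> A \<and> g \<in> A \<and> order_equivalent V f g}"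

lemma equiv_order_equivalent:
  "equiv A {(f, g). f \<in> A \<and> g \<in> A \<and> order_equivalent V f g}"
  by (rule equivI) (auto simp: refl_on_def sym_def trans_def order_equivalent_def)

end

theory Submission imports Defs begin

text \<open>A \<open>k\<close>-XOS function is given by the point \<open>(f\<^sub>i({v}))\<close> of \<open>\<real>\<^sup>k\<^sup>n\<close>, and its
  order-equivalence class depends only on which of the \<open>k\<^sup>2 4\<^sup>n\<close> linear inequalities
  \<open>f\<^sub>i(X) \<le> f\<^sub>j(Y)\<close> hold there. By induction on \<open>m\<close>, at most \<open>(m + 1)\<^sup>d\<close>
  subsets of \<open>m\<close> homogeneous linear inequalities on \<open>\<real>\<^sup>d\<close> occur as the set of inequalities
  valid at some point: a new inequality can split such a subset into two only if the
  subset already occurs on the bounding hyperplane, a space of dimension \<open>d - 1\<close>.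
  Finally \<open>(k\<^sup>2 4\<^sup>n + 1)\<^sup>k\<^sup>n \<le> 4\<^bsup>(k + n)kn\<^esup> \<le> 2\<^bsup>4k\<^sup>2n\<^sup>2\<^esup>\<close>.\<close>

section \<open>Counting patterns of homogeneous linear inequalities\<close>

definition linear_form :: "'i set \<Rightarrow> ('i \<Rightarrow> real) \<Rightarrow> ('i \<Rightarrow> real) \<Rightarrow> real" where
  "linear_form I c x = (\<Sum>i\<in>I. c i * x i)"

text \<open>Points are total functions of which only the coordinates in \<open>I\<close> matter, so
  passing to a hyperplane just removes an index from \<open>I\<close> and leaves the type of points
  unchanged.\<close>

definition halfspace_patterns :: "'m set \<Rightarrow> 'i set \<Rightarrow> ('m \<Rightarrow> 'i \<Rightarrow> real) \<Rightarrow> 'm set set" where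
  "halfspace_patterns M I b = range (\<lambda>x. {m \<in> M. linear_form I (b m) x \<le> 0})"

lemma linear_form_combination:
  "linear_form I c (\<lambda>i. s * x i + t * y i) = s * linear_form I c x + t * linear_form I c y"
  by (simp add: linear_form_def sum_distrib_left sum.distrib algebra_simps)

text \<open>Solve \<open>linear_form I c x = 0\<close> for \<open>x j\<close> and substitute: the
  remaining coordinates parametrize the hyperplane.\<close>

lemma linear_form_eliminate:
  assumes "finite I" "j \<in> I" "c j \<noteq> 0" "linear_form I c x = 0"
  shows "linear_form I d x = linear_form (I - {j}) (\<lambda>i. d i - d j * c i / c j) x"
proof -
  have c: "c j * x j + linear_form (I - {j}) c x = 0"
    using assms unfolding linear_form_def by (simp add: sum.remove)
  have "x j = - linear_form (I - {j}) c x / c j"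
    using c \<open>c j \<noteq> 0\<close> by (simp add: field_simps)
  moreover have "linear_form I d x = d j * x j + linear_form (I - {j}) d x"
    using assms unfolding linear_form_def by (simp add: sum.remove)
  moreover have "linear_form (I - {j}) (\<lambda>i. d i - d j * c i / c j) x
      = linear_form (I - {j}) d x - d j / c j * linear_form (I - {j}) c x"
    by (simp add: linear_form_def sum_distrib_left sum_subtractf algebra_simps)
  ultimately show ?thesis by simp
qed

lemma finite_halfspace_patterns:
  assumes "finite M"
  shows "finite (halfspace_patterns M I b)"
  by (rule finite_subset[of _ "Pow M"]) (use assms in \<open>auto simp: halfspace_patterns_def\<close>)

text \<open>The fibres of deleting \<open>m\<close> have one or two elements; the last summand
  counts those with two.\<close>

lemma card_family_split:
  assumes "finite S"
  shows "card S = card ((\<lambda>A. A - {m}) ` S) + card {A \<in> S. m \<notin> A \<and> insert m A \<in> S}"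
proof -
  let ?r = "\<lambda>A. A - {m}"
  let ?S1 = "{A \<in> S. m \<in> A}" and ?S0 = "{A \<in> S. m \<notin> A}"
  have fin: "finite ?S1" "finite ?S0" using assms by auto
  have inj: "inj_on ?r ?S1" by (auto simp: inj_on_def)
  have im0: "?r ` ?S0 = ?S0" by force
  have S: "S = ?S1 \<union> ?S0" by auto
  have "card S = card ?S1 + card ?S0"
    by (subst S, rule card_Un_disjoint) (use fin in auto)
  also have "\<dots> = card (?r ` ?S1) + card ?S0" by (simp add: card_image[OF inj])
  also have "\<dots> = card (?r ` ?S1 \<union> ?S0) + card (?r ` ?S1 \<inter> ?S0)"
    using fin by (intro card_Un_Int) auto
  also have "?r ` ?S1 \<union> ?S0 = ?r ` S" by (subst (3) S) (simp only: image_Un im0)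
  also have "?r ` ?S1 \<inter> ?S0 = {A \<in> S. m \<notin> A \<and> insert m A \<in> S}"
    by (auto simp: insert_absorb intro!: image_eqI[where x = "insert m _"])
  finally show ?thesis .
qed

text \<open>Two points that differ only in inequality \<open>m\<close> have a positive combination
  on its hyperplane. Both sides of every other inequality are closed under such combinations, so the
  pattern survives there, and coordinate \<open>j\<close> can be eliminated.\<close>

lemma split_patterns_on_hyperplane:
  assumes "finite I" "j \<in> I" "b m j \<noteq> 0" "m \<notin> M"
  shows "{A \<in> halfspace_patterns (insert m M) I b.
            m \<notin> A \<and> insert m A \<in> halfspace_patterns (insert m M) I b}
    \<subseteq> halfspace_patterns M (I - {j}) (\<lambda>l i. b l i - b l j * b m i / b m j)"
proof clarify
  fix A
  assume "A \<in> halfspace_patterns (insert m M) I b" "m \<notin> A"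
    and "insert m A \<in> halfspace_patterns (insert m M) I b"
  then obtain x y
    where y: "A = {l \<in> insert m M. linear_form I (b l) y \<le> 0}"
      and x: "insert m A = {l \<in> insert m M. linear_form I (b l) x \<le> 0}"
    by (auto simp: halfspace_patterns_def)
  let ?s = "linear_form I (b m) y" and ?t = "- linear_form I (b m) x"
  have s: "?s > 0" using \<open>m \<notin> A\<close> y by auto
  have t: "?t \<ge> 0" using x by auto
  \<comment> \<open>a positive multiple of the point where the segment from \<open>x\<close> to \<open>y\<close> meets the hyperplane\<close>
  define z where "z = (\<lambda>i. ?s * x i + ?t * y i)"
  have z: "linear_form I (b l) z = ?s * linear_form I (b l) x + ?t * linear_form I (b l) y" for l
    unfolding z_def by (rule linear_form_combination)
  have "l \<in> A \<longleftrightarrow> linear_form I (b l) z \<le> 0" if "l \<in> M" for l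
  proof (cases "l \<in> A")
    case True
    then have "linear_form I (b l) x \<le> 0" "linear_form I (b l) y \<le> 0"
      using x y by auto
    then have "?s * linear_form I (b l) x \<le> 0" "?t * linear_form I (b l) y \<le> 0"
      using s t by (meson less_imp_le mult_nonneg_nonpos)+
    with True z show ?thesis by simp
  next
    case False
    moreover have "l \<noteq> m" using that assms by auto
    ultimately have "linear_form I (b l) x > 0" "linear_form I (b l) y > 0"
      using x y that by (auto simp: not_le)
    \<comment> \<open>\<open>?t\<close> is 0 if \<open>x\<close> already lies on the hyperplane, so
      strictness has to come from the \<open>x\<close> term, whose weight \<open>?s\<close> is
      positive.\<close>
    then have "?s * linear_form I (b l) x > 0" "?t * linear_form I (b l) y \<ge> 0"
      using s t by (meson less_imp_le mult_nonneg_nonneg mult_pos_pos)+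
    with False z show ?thesis by simp
  qed
  moreover have "linear_form I (b m) z = 0" by (simp add: z)
  ultimately have "A = {l \<in> M. linear_form (I - {j}) (\<lambda>i. b l i - b l j * b m i / b m j) z \<le> 0}"
    using \<open>m \<notin> A\<close> y assms by (auto simp flip: linear_form_eliminate)
  then show "A \<in> halfspace_patterns M (I - {j}) (\<lambda>l i. b l i - b l j * b m i / b m j)"
    by (auto simp: halfspace_patterns_def)
qed

lemma card_halfspace_patterns_le:
  assumes "finite M" "finite I"
  shows "card (halfspace_patterns M I b) \<le> (card M + 1) ^ card I"
  using assms
\<comment> \<open>The induction hypothesis is used twice: for the same forms on \<open>I\<close>,
  and for the eliminated forms on \<open>I - {j}\<close>.\<close>
proof (induction M arbitrary: I b rule: finite_induct)
  case empty
  have "halfspace_patterns {} I b = {{}}" by (auto simp: halfspace_patterns_def)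
  then show ?case by simp
next
  case (insert m M)
  show ?case
  proof (cases "\<forall>j\<in>I. b m j = 0")
    \<comment> \<open>No index can be eliminated, but inequality \<open>m\<close> then holds
      everywhere and splits nothing.\<close>
    case True
    then have "linear_form I (b m) x = 0" for x by (simp add: linear_form_def)
    then have "halfspace_patterns (insert m M) I b = insert m ` halfspace_patterns M I b"
      by (auto simp: halfspace_patterns_def image_image intro!: image_cong arg_cong[of _ _ range])
    then have "card (halfspace_patterns (insert m M) I b) \<le> card (halfspace_patterns M I b)"
      by (simp add: card_image_le finite_halfspace_patterns insert.hyps)
    also have "\<dots> \<le> (card M + 1) ^ card I" by (rule insert.IH[OF insert.prems])
    also have "\<dots> \<le> (card (insert m M) + 1) ^ card I"
      using insert.hyps by (intro power_mono) auto
    finally show ?thesis .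
  next
    case False
    then obtain j where j: "j \<in> I" "b m j \<noteq> 0" by auto
    let ?S = "halfspace_patterns (insert m M) I b"
    have restr: "(\<lambda>A. A - {m}) ` ?S = halfspace_patterns M I b"
      unfolding halfspace_patterns_def image_image
      using insert.hyps by (intro image_cong) auto
    obtain d where d: "card I = Suc d" "card (I - {j}) = d"
      using j insert.prems card_Suc_Diff1 by metis
    have "card ?S = card (halfspace_patterns M I b) + card {A \<in> ?S. m \<notin> A \<and> insert m A \<in> ?S}"
      using card_family_split[of ?S m] finite_halfspace_patterns[of "insert m M" I b] insert.hyps
      by (simp add: restr)
    also have "\<dots> \<le> (card M + 1) ^ card I + (card M + 1) ^ card (I - {j})"
    proof (rule add_mono[OF insert.IH[OF insert.prems]])
      let ?b = "\<lambda>l i. b l i - b l j * b m i / b m j"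
      have "card {A \<in> ?S. m \<notin> A \<and> insert m A \<in> ?S} \<le> card (halfspace_patterns M (I - {j}) ?b)"
        using split_patterns_on_hyperplane[of I j b m M] j insert.prems insert.hyps
        by (intro card_mono finite_halfspace_patterns) auto
      also have "\<dots> \<le> (card M + 1) ^ card (I - {j})"
        using insert.prems by (intro insert.IH) auto
      finally show "card {A \<in> ?S. m \<notin> A \<and> insert m A \<in> ?S} \<le> (card M + 1) ^ card (I - {j})" .
    qed
    \<comment> \<open>Factoring out the common power leaves \<open>card M + 2\<close>, exactly the
      base of the bound for \<open>insert m M\<close>.\<close>
    also have "\<dots> = (card M + 1) ^ d * (card M + 2)"
      by (simp add: d algebra_simps)
    also have "\<dots> \<le> (card M + 2) ^ d * (card M + 2)"
      by (intro mult_right_mono power_mono) auto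
    also have "\<dots> = (card (insert m M) + 1) ^ card I"
      using insert.hyps by (simp add: d)
    finally show ?thesis .
  qed
qed

section \<open>From patterns to order-equivalence classes\<close>

lemma quotient_card_le_invariant:
  assumes "equiv A r" "finite P" "\<And>f. f \<in> A \<Longrightarrow> p f \<in> P"
    and "\<And>f g. f \<in> A \<Longrightarrow> g \<in> A \<Longrightarrow> p f = p g \<Longrightarrow> (f, g) \<in> r"
  shows "finite (A // r)" "card (A // r) \<le> card P"
proof -
  \<comment> \<open>Each value of \<open>p\<close> determines the class of any member attaining it.
    One class may have several values, so the map goes from values to classes.\<close>
  have "A // r \<subseteq> (\<lambda>q. r `` {SOME g. g \<in> A \<and> p g = q}) ` P"
  proof
    fix c assume "c \<in> A // r"
    then obtain f where f: "f \<in> A" "c = r `` {f}" by (auto elim: quotientE)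
    let ?g = "SOME g. g \<in> A \<and> p g = p f"
    have "?g \<in> A \<and> p ?g = p f" by (rule someI[of _ f]) (use f in simp)
    then have "(f, ?g) \<in> r" using assms(4) f by metis
    then have "c = r `` {?g}" using f equiv_class_eq[OF assms(1)] by metis
    then show "c \<in> (\<lambda>q. r `` {SOME g. g \<in> A \<and> p g = q}) ` P" using assms(3) f by blast
  qed
  with \<open>finite P\<close> show "finite (A // r)" "card (A // r) \<le> card P"
    by (auto intro: finite_subset surj_card_le)
qed

text \<open>As a difference of indicators, the coefficient cancels by itself when
  \<open>i = j\<close> and \<open>v\<close> lies in both sets.\<close>

definition comparison_coeff :: "nat \<times> nat \<times> 'a set \<times> 'a set \<Rightarrow> nat \<times> 'a \<Rightarrow> real" where
  "comparison_coeff = (\<lambda>(i, j, X, Y) (l, v).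
     of_bool (l = i \<and> v \<in> X) - of_bool (l = j \<and> v \<in> Y))"

lemma linear_form_comparison_coeff:
  assumes "finite V" "i \<in> {1..k}" "j \<in> {1..k}" "X \<subseteq> V" "Y \<subseteq> V"
    and "additive_set_fun V (F i)" "additive_set_fun V (F j)"
  shows "linear_form ({1..k} \<times> V) (comparison_coeff (i, j, X, Y)) (\<lambda>(l, v). F l {v}) = F i X - F j Y"
proof -
  have *: "(\<Sum>(l, v)\<in>{1..k} \<times> V. of_bool (l = h \<and> v \<in> Z) * F l {v}) = F h Z"
    if "h \<in> {1..k}" "Z \<subseteq> V" "additive_set_fun V (F h)" for h Z
  proof -
    have "(\<Sum>(l, v)\<in>{1..k} \<times> V. of_bool (l = h \<and> v \<in> Z) * F l {v})
        = (\<Sum>(l, v)\<in>{h} \<times> Z. F l {v})"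
      using that assms(1) by (intro sum.mono_neutral_cong_right) auto
    also have "\<dots> = (\<Sum>v\<in>Z. F h {v})"
      by (simp flip: sum.cartesian_product)
    finally show ?thesis using that by (auto simp: additive_set_fun_def)
  qed
  show ?thesis
    using *[of i X] *[of j Y] assms
    by (simp add: linear_form_def comparison_coeff_def case_prod_unfold left_diff_distrib sum_subtractf)
qed

lemma Max_image_le_Max_image_iff:
  fixes f g :: "'a \<Rightarrow> 'b::linorder"
  assumes "finite I" "I \<noteq> {}"
  shows "Max (f ` I) \<le> Max (g ` I) \<longleftrightarrow> (\<forall>i\<in>I. \<exists>j\<in>I. f i \<le> g j)"
  using assms by (subst Max.bounded_iff) (auto simp: Max_ge_iff)

lemma card_order_classes_le:
  assumes V: "finite V" and k: "k \<ge> 1"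
  shows "finite (order_classes V (k_xos_functions V k))"
    and "card (order_classes V (k_xos_functions V k)) \<le> (k\<^sup>2 * 4 ^ card V + 1) ^ (k * card V)"
proof -
  let ?M = "{1..k} \<times> {1..k} \<times> Pow V \<times> Pow V"
  let ?P = "halfspace_patterns ?M ({1..k} \<times> V) comparison_coeff"
  let ?A = "k_xos_functions V k"
  define rep where "rep f F \<longleftrightarrow> (\<forall>i\<in>{1..k}. additive_set_fun V (F i)) \<and>
    (\<forall>X. X \<subseteq> V \<longrightarrow> f X = Max ((\<lambda>i. F i X) ` {1..k}))"
    for f :: "'a set \<Rightarrow> real" and F :: "nat \<Rightarrow> 'a set \<Rightarrow> real"
  define pat where "pat F = {(i, j, X, Y) \<in> ?M. F i X \<le> F j Y}" for F :: "nat \<Rightarrow> 'a set \<Rightarrow> real"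
  \<comment> \<open>Different representations of \<open>f\<close> may have different patterns; an
    arbitrary choice suffices, since equal patterns force equal orders.\<close>
  define p where "p f = pat (SOME F. rep f F)" for f
  have rep: "rep f (SOME F. rep f F)" if "f \<in> ?A" for f
  proof (rule someI_ex[where P = "rep f"])
    show "\<exists>F. rep f F" using that by (simp add: k_xos_functions_def k_xos_def rep_def)
  qed
  have finM: "finite ?M" using V by simp
  have p_in: "p f \<in> ?P" if "f \<in> ?A" for f
  proof -
    define F where "F = (SOME F. rep f F)"
    have "rep f F" unfolding F_def by (rule rep[OF that])
    then have "p f = {m \<in> ?M. linear_form ({1..k} \<times> V) (comparison_coeff m) (\<lambda>(l, v). F l {v}) \<le> 0}"
      unfolding p_def pat_def F_def[symmetric] rep_def
      using linear_form_comparison_coeff[OF V, of _ k _ _ _ F] by auto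
    then show ?thesis by (auto simp: halfspace_patterns_def)
  qed
  \<comment> \<open>A maximum is below another iff each of its members is below some member of the
    other, so the pattern determines the order.\<close>
  have le_iff: "f X \<le> f Y \<longleftrightarrow> (\<forall>i\<in>{1..k}. \<exists>j\<in>{1..k}. (i, j, X, Y) \<in> p f)"
    if "f \<in> ?A" "X \<subseteq> V" "Y \<subseteq> V" for f X Y
  proof -
    have "f X \<le> f Y \<longleftrightarrow> (\<forall>i\<in>{1..k}. \<exists>j\<in>{1..k}. (SOME F. rep f F) i X \<le> (SOME F. rep f F) j Y)"
      using rep[OF that(1)] that k unfolding rep_def
      by (subst Max_image_le_Max_image_iff[symmetric]) auto
    then show ?thesis using that by (simp add: p_def pat_def)
  qed
  have eq: "(f, g) \<in> {(f, g). f \<in> ?A \<and> g \<in> ?A \<and> order_equivalent V f g}"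
    if "f \<in> ?A" "g \<in> ?A" "p f = p g" for f g
    using that by (auto simp: order_equivalent_def le_iff)
  note * = quotient_card_le_invariant[OF equiv_order_equivalent finite_halfspace_patterns[OF finM] p_in eq]
  show "finite (order_classes V ?A)"
    unfolding order_classes_def by (rule *(1))
  have "card (order_classes V ?A) \<le> card ?P"
    unfolding order_classes_def by (rule *(2))
  also have "\<dots> \<le> (card ?M + 1) ^ card ({1..k} \<times> V)"
    using V by (intro card_halfspace_patterns_le) auto
  also have "card ?M = k\<^sup>2 * 4 ^ card V"
    by (simp add: card_cartesian_product card_Pow V power2_eq_square flip: power_mult_distrib)
  also have "card ({1..k} \<times> V) = k * card V"
    by (simp add: card_cartesian_product)
  finally show "card (order_classes V ?A) \<le> (k\<^sup>2 * 4 ^ card V + 1) ^ (k * card V)" .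
qed

section \<open>The numerical estimate\<close>

lemma xos_bound_le:
  fixes k n :: nat
  assumes "k \<ge> 1"
  shows "(k\<^sup>2 * 4 ^ n + 1) ^ (k * n) \<le> 2 ^ (4 * k\<^sup>2 * n\<^sup>2)"
\<comment> \<open>For \<open>n = 0\<close> both sides are 1; the estimate
  \<open>k + n \<le> 2 * (k * n)\<close> used below fails there.\<close>
proof (cases "n = 0")
  case False
  have "k < 2 ^ k" by (rule less_exp)
  \<comment> \<open>Strictness is what absorbs the summand 1 in the next line.\<close>
  then have "k\<^sup>2 < (2 ^ k)\<^sup>2" by (intro power_strict_mono) auto
  then have "k\<^sup>2 + 1 \<le> 4 ^ k" by (simp add: power2_eq_square flip: power_mult_distrib)
  then have "(k\<^sup>2 + 1) * 4 ^ n \<le> 4 ^ k * 4 ^ n" by (rule mult_right_mono) simp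
  moreover have "k\<^sup>2 * 4 ^ n + 1 \<le> (k\<^sup>2 + 1) * 4 ^ n" by simp
  ultimately have "k\<^sup>2 * 4 ^ n + 1 \<le> 4 ^ (k + n)"
    unfolding power_add by (rule order_trans[rotated])
  then have "(k\<^sup>2 * 4 ^ n + 1) ^ (k * n) \<le> (4 ^ (k + n)) ^ (k * n)"
    by (rule power_mono) simp
  also have "(4::nat) = 2 ^ 2" by simp
  also have "((2 ^ 2) ^ (k + n)) ^ (k * n) = (2::nat) ^ (2 * (k + n) * (k * n))"
    by (simp only: power_mult)
  also have "\<dots> \<le> 2 ^ (4 * k\<^sup>2 * n\<^sup>2)"
  proof (rule power_increasing)
    have "k \<le> k * n" "n \<le> k * n" using assms False by simp_all
    then have "k + n \<le> 2 * (k * n)" by linarith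
    then have "2 * (k + n) * (k * n) \<le> 2 * (2 * (k * n)) * (k * n)"
      by (intro mult_right_mono mult_left_mono) auto
    then show "2 * (k + n) * (k * n) \<le> 4 * k\<^sup>2 * n\<^sup>2" by (simp add: power2_eq_square algebra_simps)
  qed simp
  finally show ?thesis by simp
qed simp

theorem theorem22:
  "\<exists>C::real. \<forall>(k::nat) (n::nat). k \<ge> 1 \<longrightarrow>
     finite (order_classes {1..n} (k_xos_functions {1..n} k)) \<and>
     real (card (order_classes {1..n} (k_xos_functions {1..n} k)))
       \<le> 2 powr (C * real k ^ 2 * real n ^ 2)"
\<comment> \<open>The constant 4 is the one in the exponent of \<open>xos_bound_le\<close>, uniform
  in \<open>k\<close> and \<open>n\<close>.\<close>
proof (intro exI[of _ 4] allI impI conjI)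
  fix k n :: nat assume k: "k \<ge> 1"
  let ?N = "card (order_classes {1..n} (k_xos_functions {1..n} k))"
  show "finite (order_classes {1..n} (k_xos_functions {1..n} k))"
    using k by (intro card_order_classes_le) auto
  have "?N \<le> (k\<^sup>2 * 4 ^ n + 1) ^ (k * n)"
    using card_order_classes_le(2)[of "{1..n}" k] k by simp
  also have "\<dots> \<le> 2 ^ (4 * k\<^sup>2 * n\<^sup>2)" by (rule xos_bound_le[OF k])
  finally have "real ?N \<le> 2 ^ (4 * k\<^sup>2 * n\<^sup>2)"
    by (metis of_nat_le_iff of_nat_numeral of_nat_power)
  also have "\<dots> = 2 powr real (4 * k\<^sup>2 * n\<^sup>2)" by (rule powr_realpow[symmetric]) simp
  finally show "real ?N \<le> 2 powr (4 * real k ^ 2 * real n ^ 2)" by simp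
qed

end
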